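(* Let $\{F^{ij}\}$ be a set of real fundamental matrices with corresponding graph $\mathcal{G}$. Then $\{F^{ij}\}$ is compatible if and only if there are matrices $H_i\in\mathrm{GL}_3(\mathbb{R})$ and scalars $\lambda_{ij}=\lambda_{ji}\neq 0$ such that the matrices $G^{ij}:=\lambda_{ij}H_i^TF^{ij}H_j$ satisfy the cycle condition $$\sum_{(ij)\in E(C)}G^{ij}=0\quad\text{for each directed cycle } C \text{ of } \mathcal{G}.$$ In particular, any set of $3\times 3$ rank-2 matrices $G^{ij}$ satisfying this cycle condition are the fundamental matrices of some set of cameras.
   Context: Everything is over $\mathbb{R}$. A camera is a rank-3 real $3\times 4$ matrix (up to nonzero scale). A fundamental matrix is a rank-2 real $3\times 3$ matrix. For $3\times 4$ matrices $P_1,P_2$, $\psi(P_1,P_2)$ is the $3\times3$ matrix $F$ (up to scale) with $\det\begin{bmatrix}P_1&x&0\\P_2&0&y\end{bmatrix}=x^TFy$ for all $x,y\in\mathbb{R}^3$. The set $\{F^{ij}\}$ is indexed by some subset of the $\binom n2$ pairs of distinct indices in $\{1,\dots,n\}$; the corresponding graph $\mathcal{G}=(V,E)$ has vertex set $V$ the set of indices, and edge set $E$ the pairs of indices for which a fundamental matrix is given. Affine representatives are fixed with $F^{ji}=(F^{ij})^T$ (likewise $G^{ji}=(G^{ij})^T$). The set $\{F^{ij}\}$ is compatible if there are cameras $P_i$, $i\in V$, with $F^{ij}=\psi(P_i,P_j)$ up to nonzero scale for every edge $(ij)\in E$; in that case the $F^{ij}$ are said to be the fundamental matrices of the cameras $P_i$.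 A directed cycle $C$ of $\mathcal{G}$ is a closed path, i.e. a path that starts and ends at the same vertex, and $E(C)$ is its collection of directed edges; cycles of length two ($i\to j\to i$ along an edge) are included, so the cycle condition contains $G^{ij}+G^{ji}=0$. *)

theory Defs
  imports "HOL-Analysis.Analysis" "Graph_Theory.Pair_Digraph"
begin

text \<open>Cameras and fundamental matrices are handled through affine representatives; scale
  ambiguity appears as an explicit nonzero factor in \<open>compatible_fundamental\<close>.\<close>

definition is_camera :: "real^4^3 \<Rightarrow> bool" where
  "is_camera P \<longleftrightarrow> rank P = 3"

definition is_fundamental_matrix :: "real^3^3 \<Rightarrow> bool" where
  "is_fundamental_matrix F \<longleftrightarrow> rank F = 2"

text \<open>The block matrix with block rows \<open>(P x 0)\<close> and \<open>(Q 0 y)\<close>.\<close>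

definition two_view_matrix :: "real^4^3 \<Rightarrow> real^4^3 \<Rightarrow> real^3 \<Rightarrow> real^3 \<Rightarrow> real^6^6" where
  "two_view_matrix P Q x y = vector [
     vector [P$1$1, P$1$2, P$1$3, P$1$4, x$1, 0],
     vector [P$2$1, P$2$2, P$2$3, P$2$4, x$2, 0],
     vector [P$3$1, P$3$2, P$3$3, P$3$4, x$3, 0],
     vector [Q$1$1, Q$1$2, Q$1$3, Q$1$4, 0, y$1],
     vector [Q$2$1, Q$2$2, Q$2$3, Q$2$4, 0, y$2],
     vector [Q$3$1, Q$3$2, Q$3$3, Q$3$4, 0, y$3]]"

text \<open>The description is proper: existence and uniqueness are shown in \<open>psi_ex1\<close> below.\<close>

definition psi :: "real^4^3 \<Rightarrow> real^4^3 \<Rightarrow> real^3^3" where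
  "psi P Q = (THE F. \<forall>x y. det (two_view_matrix P Q x y) = x \<bullet> (F *v y))"

text \<open>A simple graph is a \<open>pair_graph\<close>, i.e. a finite, loop-free, symmetric digraph: an edge
  is a pair of opposite arcs. The values \<open>F i j\<close> are relevant only on arcs.\<close>

definition fundamental_matrices_on ::
    "'v pair_pre_digraph \<Rightarrow> ('v \<Rightarrow> 'v \<Rightarrow> real^3^3) \<Rightarrow> bool" where
  "fundamental_matrices_on \<G> F \<longleftrightarrow>
     (\<forall>(i, j) \<in> parcs \<G>. is_fundamental_matrix (F i j) \<and> F j i = transpose (F i j))"

definition fundamental_matrices_of_cameras ::
    "'v pair_pre_digraph \<Rightarrow> ('v \<Rightarrow> 'v \<Rightarrow> real^3^3) \<Rightarrow> ('v \<Rightarrow> real^4^3) \<Rightarrow> bool" where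
  "fundamental_matrices_of_cameras \<G> F P \<longleftrightarrow>
     (\<forall>(i, j) \<in> parcs \<G>. \<exists>c. c \<noteq> 0 \<and> F i j = c *\<^sub>R psi (P i) (P j))"

definition compatible_fundamental ::
    "'v pair_pre_digraph \<Rightarrow> ('v \<Rightarrow> 'v \<Rightarrow> real^3^3) \<Rightarrow> bool" where
  "compatible_fundamental \<G> F \<longleftrightarrow>
     (\<exists>P. (\<forall>i \<in> pverts \<G>. is_camera (P i)) \<and> fundamental_matrices_of_cameras \<G> F P)"

text \<open>The library's \<open>cycle\<close> is a nonempty closed arc walk visiting no vertex twice apart from
  its coinciding endpoints; in a symmetric digraph this includes \<open>[(i, j), (j, i)]\<close>. Its arcs
  are pairwise distinct, so summing over their set loses no multiplicities.\<close>

definition cycle_condition ::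
    "'v pair_pre_digraph \<Rightarrow> ('v \<Rightarrow> 'v \<Rightarrow> real^3^3) \<Rightarrow> bool" where
  "cycle_condition \<G> G \<longleftrightarrow>
     (\<forall>C. pre_digraph.cycle (with_proj \<G>) C \<longrightarrow> (\<Sum>(i, j) \<in> set C. G i j) = 0)"

lemma UNIV_six: "(UNIV :: 6 set) = {1, 2, 3, 4, 5, 6}"
proof -
  have "card {1, 2, 3, 4, 5, 6 :: 6} = card (UNIV :: 6 set)"
    by simp
  then show ?thesis
    by (metis card_subset_eq finite subset_UNIV)
qed

lemma forall_six: "(\<forall>i::6. P i) \<longleftrightarrow> P 1 \<and> P 2 \<and> P 3 \<and> P 4 \<and> P 5 \<and> P 6"
proof -
  have "(\<forall>i::6. P i) \<longleftrightarrow> (\<forall>i \<in> (UNIV :: 6 set). P i)" by simp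
  then show ?thesis unfolding UNIV_six by simp
qed

lemma vector_six:
  "(vector [a, b, c, d, e, f] :: 'a::zero^6) $ 1 = a"
  "(vector [a, b, c, d, e, f] :: 'a^6) $ 2 = b"
  "(vector [a, b, c, d, e, f] :: 'a^6) $ 3 = c"
  "(vector [a, b, c, d, e, f] :: 'a^6) $ 4 = d"
  "(vector [a, b, c, d, e, f] :: 'a^6) $ 5 = e"
  "(vector [a, b, c, d, e, f] :: 'a^6) $ 6 = f"
  by (simp_all add: vector_def)

lemma linear_det_two_view_matrix:
  "linear (\<lambda>x. det (two_view_matrix P Q x y))"
  "linear (\<lambda>y. det (two_view_matrix P Q x y))"
proof -
  define u :: "real^3 \<Rightarrow> real^6" where "u x = vector [x$1, x$2, x$3, 0, 0, 0]" for x
  define v :: "real^3 \<Rightarrow> real^6" where "v y = vector [0, 0, 0, y$1, y$2, y$3]" for y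
  have u: "u (x + x') = u x + u x'" "u (c *\<^sub>R x) = c *s u x" for x x' c
    by (simp_all add: u_def vec_eq_iff forall_six vector_six)
  have v: "v (x + x') = v x + v x'" "v (c *\<^sub>R x) = c *s v x" for x x' c
    by (simp_all add: v_def vec_eq_iff forall_six vector_six)
  have T5: "transpose (two_view_matrix P Q x y) =
      (\<chi> i. if i = 5 then u x else transpose (two_view_matrix P Q 0 y) $ i)" for x y
    by (simp add: two_view_matrix_def u_def vec_eq_iff forall_six vector_six transpose_def)
  have T6: "transpose (two_view_matrix P Q x y) =
      (\<chi> i. if i = 6 then v y else transpose (two_view_matrix P Q x 0) $ i)" for x y
    by (simp add: two_view_matrix_def v_def vec_eq_iff forall_six vector_six transpose_def)
  have D5: "det (two_view_matrix P Q x y) =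
      det (\<chi> i. if i = 5 then u x else transpose (two_view_matrix P Q 0 y) $ i)" for x y
    using det_transpose [of "two_view_matrix P Q x y"] T5 [of x y] by simp
  have D6: "det (two_view_matrix P Q x y) =
      det (\<chi> i. if i = 6 then v y else transpose (two_view_matrix P Q x 0) $ i)" for x y
    using det_transpose [of "two_view_matrix P Q x y"] T6 [of x y] by simp
  show "linear (\<lambda>x. det (two_view_matrix P Q x y))"
    unfolding D5 [of _ y] by (rule linearI)
      (simp_all add: u det_row_mul [of 5 _ "\<lambda>_. u _"]
        det_row_add [of 5 "\<lambda>_. u _" "\<lambda>_. u _"] cong del: if_weak_cong)
  show "linear (\<lambda>y. det (two_view_matrix P Q x y))"
    unfolding D6 [of x] by (rule linearI)
      (simp_all add: v det_row_mul [of 6 _ "\<lambda>_. v _"]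
        det_row_add [of 6 "\<lambda>_. v _" "\<lambda>_. v _"] cong del: if_weak_cong)
qed

lemma psi_ex1: "\<exists>!F. \<forall>x y. det (two_view_matrix P Q x y) = x \<bullet> (F *v y)"
proof (rule ex_ex1I)
  define B where "B x y = det (two_view_matrix P Q x y)" for x y
  have lin: "linear (\<lambda>x. B x y)" "linear (\<lambda>y. B x y)" for x y
    unfolding B_def by (rule linear_det_two_view_matrix)+
  have "B x y = x \<bullet> ((\<chi> i j. B (axis i 1) (axis j 1)) *v y)" for x y
  proof -
    have ex: "z = (\<Sum>i\<in>UNIV. (z $ i) *\<^sub>R axis i 1)" for z :: "real^3"
      by (simp add: basis_expansion flip: scalar_mult_eq_scaleR)
    have "B x y = (\<Sum>i\<in>UNIV. x $ i * B (axis i 1) y)"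
      by (subst ex [of x]) (simp add: linear_sum [OF lin(1)] linear_cmul [OF lin(1)])
    also have "\<dots> = (\<Sum>i\<in>UNIV. x $ i * (\<Sum>j\<in>UNIV. y $ j * B (axis i 1) (axis j 1)))"
      by (subst ex [of y]) (simp add: linear_sum [OF lin(2)] linear_cmul [OF lin(2)])
    finally show ?thesis
      by (simp add: inner_vec_def matrix_vector_mult_def mult.commute)
  qed
  then show "\<exists>F. \<forall>x y. det (two_view_matrix P Q x y) = x \<bullet> (F *v y)"
    unfolding B_def by blast
next
  fix F F' :: "real^3^3"
  assume "\<forall>x y. det (two_view_matrix P Q x y) = x \<bullet> (F *v y)"
    and "\<forall>x y. det (two_view_matrix P Q x y) = x \<bullet> (F' *v y)"
  then have "x \<bullet> (F *v y) = x \<bullet> (F' *v y)" for x y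
    by simp
  then have "F *v y = F' *v y" for y
    by (metis vector_eq_rdot inner_commute)
  then show "F = F'"
    by (simp add: matrix_eq)
qed

lemma det_two_view_matrix: "det (two_view_matrix P Q x y) = x \<bullet> (psi P Q *v y)"
  using theI' [OF psi_ex1 [of P Q]] unfolding psi_def by blast

end

theory Submission
  imports Defs
begin

text \<open>A projective change of world coordinates brings finitely many cameras simultaneously into
  the form \<open>P\<^sub>i = A\<^sub>i [I | t\<^sub>i]\<close> with \<open>A\<^sub>i\<close> invertible: the new plane at infinity only has to
  miss the finitely many camera centres. Changes of coordinates act on \<open>psi\<close> by
  \<open>A\<^sub>i\<^sup>T psi(P\<^sub>i, P\<^sub>j) A\<^sub>j \<sim> [t\<^sub>i - t\<^sub>j]\<^sub>\<times>\<close>. So compatibility means that, after scaling and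
  multiplying by invertible matrices, the \<open>F\<^sup>i\<^sup>j\<close> become differences \<open>[t\<^sub>i]\<^sub>\<times> - [t\<^sub>j]\<^sub>\<times>\<close>. A family
  indexed by arcs is such a coboundary iff it sums to zero along cycles; the 2-cycles
  together with \<open>G\<^sup>j\<^sup>i = (G\<^sup>i\<^sup>j)\<^sup>T\<close> supply skew-symmetry.\<close>

section \<open>Closed walks and potentials in symmetric digraphs\<close>

text \<open>Induction on length: a repeated vertex splits off a closed subwalk, and both this piece
  and the remaining closed walk are shorter. Without repetition the walk is empty or a cycle, where
  list sum and set sum agree.\<close>

lemma (in wf_digraph) sum_list_closed_awalk:
  fixes g :: "'b \<Rightarrow> 'c::ab_group_add"
  assumes cyc: "\<And>C. cycle C \<Longrightarrow> sum g (set C) = 0"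
    and "awalk u p u"
  shows "sum_list (map g p) = 0"
  using assms(2)
proof (induction "length p" arbitrary: u p rule: less_induct)
  case less
  show ?case
  proof (cases "p = [] \<or> distinct (tl (awalk_verts u p))")
    case True
    then show ?thesis
      using less.prems cyc [of p] distinct_tl_verts_imp_distinct [of u p u]
      by (cases "p = []") (auto simp: cycle_def sum_list_distinct_conv_sum_set)
  next
    case False
    \<comment> \<open>The first arc is set aside so that the closed piece \<open>r\<close> cut out
      of \<open>es\<close> is strictly shorter than \<open>p\<close>.\<close>
    then obtain e es where p: "p = e # es" by (cases p) auto
    with False less.prems
    have es: "e \<in> arcs G" "tail G e = u" "awalk (head G e) es u"
        "\<not> distinct (awalk_verts (head G e) es)"
      by (auto simp: awalk_Cons_iff)
    obtain q r s w where d: "es = q @ r @ s" "0 < length r"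
        "awalk (head G e) q w" "awalk w r w" "awalk w s u"
      using awalk_not_distinct_decomp [OF es(3,4)] by blast
    have "awalk u (e # q @ s) u"
      using d es by (auto simp: awalk_Cons_iff)
    then have "sum_list (map g (e # q @ s)) = 0"
      by (rule less.hyps [rotated]) (use d p in simp)
    moreover have "sum_list (map g r) = 0"
      by (rule less.hyps [OF _ d(4)]) (use d p in simp)
    ultimately show ?thesis
      using d p by simp
  qed
qed

text \<open>In each component, \<open>f v\<close> sums \<open>g\<close> along a chosen walk from
  \<open>v\<close> to a base vertex. Walks with the same ends have equal sums, because one return
  walk closes both.\<close>

lemma (in sym_digraph) potential_exists:
  fixes g :: "'b \<Rightarrow> 'c::ab_group_add"
  assumes cyc: "\<And>C. cycle C \<Longrightarrow> sum g (set C) = 0"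
  shows "\<exists>f. \<forall>e\<in>arcs G. g e = f (tail G e) - f (head G e)"
proof -
  \<comment> \<open>The choice depends on \<open>v\<close> only through the set of vertices
    reachable from it, so both ends of an arc get the same base vertex.\<close>
  define r where "r v = (SOME u. v \<rightarrow>\<^sup>* u)" for v
  define q where "q v = (SOME p. awalk v p (r v))" for v
  define f where "f v = sum_list (map g (q v))" for v
  have r: "v \<rightarrow>\<^sup>* r v" if "v \<in> verts G" for v
    unfolding r_def using reachable_refl [OF that] by (rule someI)
  have q: "awalk v (q v) (r v)" if "v \<in> verts G" for v
    unfolding q_def by (rule someI_ex) (use r [OF that] in \<open>simp add: reachable_awalk\<close>)
  have "g e = f (tail G e) - f (head G e)" if e: "e \<in> arcs G" for e
  proof -
    let ?v = "tail G e" and ?w = "head G e"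
    have vw: "?v \<rightarrow>\<^sup>* ?w" "?v \<in> verts G" "?w \<in> verts G"
      using e arc_implies_awalk [OF e] by (auto intro: reachable_awalkI)
    then have "?w \<rightarrow>\<^sup>* ?v"
      using symmetric_reachable' by blast
    with vw(1) have "?v \<rightarrow>\<^sup>* u \<longleftrightarrow> ?w \<rightarrow>\<^sup>* u" for u
      by (blast intro: reachable_trans)
    then have eq: "r ?v = r ?w"
      by (simp add: r_def)
    obtain b where b: "awalk (r ?v) b ?v"
      using symmetric_reachable' [OF r [OF vw(2)]] by (auto simp: reachable_awalk)
    have "awalk ?v (q ?v @ b) ?v" "awalk ?v (e # q ?w @ b) ?v"
      using q [OF vw(2)] q [OF vw(3)] b e eq by (auto simp: awalk_Cons_iff)
    then have "sum_list (map g (q ?v @ b)) = 0" "sum_list (map g (e # q ?w @ b)) = 0"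
      using sum_list_closed_awalk [of g, OF cyc] by blast+
    then have "g e + f ?w + sum_list (map g b) = f ?v + sum_list (map g b)"
      by (simp add: f_def add.assoc)
    then show ?thesis
      by (simp add: eq_diff_eq)
  qed
  then show ?thesis by blast
qed

lemma (in wf_digraph) sum_list_awalk_telescope:
  fixes f :: "'a \<Rightarrow> 'c::ab_group_add"
  assumes "awalk u p v"
  shows "(\<Sum>e\<leftarrow>p. f (tail G e) - f (head G e)) = f u - f v"
  using assms by (induction p arbitrary: u) (auto simp: awalk_simps)

lemma (in wf_digraph) sum_cycle_telescope:
  fixes f :: "'a \<Rightarrow> 'c::ab_group_add"
  assumes "cycle C"
  shows "(\<Sum>e\<in>set C. f (tail G e) - f (head G e)) = 0"
  using assms sum_list_awalk_telescope [of _ C _ f]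
  by (auto simp: cycle_conv simp flip: sum_list_distinct_conv_sum_set)

section \<open>Coordinate changes in the world and in the images\<close>

lemma sum_six: "sum f (UNIV :: 6 set) = f 1 + f 2 + f 3 + f 4 + f 5 + f 6"
  unfolding UNIV_six by (simp add: add.assoc)

lemma vector_four:
  "(vector [a, b, c, d] :: 'a::zero^4) $ 1 = a"
  "(vector [a, b, c, d] :: 'a^4) $ 2 = b"
  "(vector [a, b, c, d] :: 'a^4) $ 3 = c"
  "(vector [a, b, c, d] :: 'a^4) $ 4 = d"
  by (simp_all add: vector_def)

lemmas entrywise =
  vec_eq_iff forall_3 forall_4 forall_six vector_six matrix_matrix_mult_def
  matrix_vector_mult_def sum_3 sum_4 sum_six mat_def vector_four

definition world_block :: "real^4^4 \<Rightarrow> real^6^6" where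
  "world_block T = vector [
     vector [T$1$1, T$1$2, T$1$3, T$1$4, 0, 0],
     vector [T$2$1, T$2$2, T$2$3, T$2$4, 0, 0],
     vector [T$3$1, T$3$2, T$3$3, T$3$4, 0, 0],
     vector [T$4$1, T$4$2, T$4$3, T$4$4, 0, 0],
     vector [0, 0, 0, 0, 1, 0],
     vector [0, 0, 0, 0, 0, 1]]"

definition image_block :: "real^3^3 \<Rightarrow> real^3^3 \<Rightarrow> real^6^6" where
  "image_block A B = vector [
     vector [A$1$1, A$1$2, A$1$3, 0, 0, 0],
     vector [A$2$1, A$2$2, A$2$3, 0, 0, 0],
     vector [A$3$1, A$3$2, A$3$3, 0, 0, 0],
     vector [0, 0, 0, B$1$1, B$1$2, B$1$3],
     vector [0, 0, 0, B$2$1, B$2$2, B$2$3],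
     vector [0, 0, 0, B$3$1, B$3$2, B$3$3]]"

lemma world_block_mult: "world_block S ** world_block T = world_block (S ** T)"
  by (simp add: world_block_def entrywise)

lemma image_block_mult: "image_block A B ** image_block C D = image_block (A ** C) (B ** D)"
  by (simp add: image_block_def entrywise)

lemma block_one: "world_block (mat 1) = mat 1" "image_block (mat 1) (mat 1) = mat 1"
  by (simp_all add: world_block_def image_block_def entrywise)

text \<open>Blocks multiply separately, so an inverse of \<open>T\<close> yields one of the whole
  matrix. This gives nonvanishing without expanding a determinant.\<close>

lemma det_world_block:
  assumes "invertible T" shows "det (world_block T) \<noteq> 0"
proof -
  obtain S where "T ** S = mat 1"
    using assms by (auto simp: invertible_def)
  then have "det (world_block T) * det (world_block S) = 1"
    by (simp add: world_block_mult block_one flip: det_mul)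
  then show ?thesis by auto
qed

lemma det_image_block:
  assumes "invertible A" "invertible B" shows "det (image_block A B) \<noteq> 0"
proof -
  obtain C D where "A ** C = mat 1" "B ** D = mat 1"
    using assms by (auto simp: invertible_def)
  then have "det (image_block A B) * det (image_block C D) = 1"
    by (simp add: image_block_mult block_one flip: det_mul)
  then show ?thesis by auto
qed

text \<open>On the left, \<open>A\<close> and \<open>B\<close> act on cameras and image points
  alike, hence the arguments \<open>A *v x\<close> and \<open>B *v y\<close>; on the right,
  \<open>T\<close> acts on the four world columns only.\<close>

lemma two_view_matrix_mult:
  "two_view_matrix (A ** P ** T) (B ** Q ** T) (A *v x) (B *v y) =
     image_block A B ** two_view_matrix P Q x y ** world_block T"
proof -
  have 1: "two_view_matrix (A ** P) (B ** Q) (A *v x) (B *v y) =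
      image_block A B ** two_view_matrix P Q x y" for P Q
    by (simp add: image_block_def two_view_matrix_def entrywise)
  have 2: "two_view_matrix (P ** T) (Q ** T) x y = two_view_matrix P Q x y ** world_block T"
    for P Q x y
    by (simp add: world_block_def two_view_matrix_def entrywise)
  show ?thesis by (simp add: 1 2)
qed

lemma matrix_eq_inner: "A = B \<longleftrightarrow> (\<forall>x y. x \<bullet> (A *v y) = x \<bullet> (B *v y))" for A B :: "real^'n^'m"
  by (metis matrix_eq vector_eq_ldot)

lemma inner_transpose_mult: "x \<bullet> (transpose A *v z) = (A *v x) \<bullet> z" for A :: "real^'n^'m"
  by (metis dot_lmul_matrix inner_commute transpose_matrix_vector)

text \<open>Taking determinants in \<open>two_view_matrix_mult\<close> compares the two bilinear
  forms; the factor is the product of the block determinants.\<close>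

lemma psi_mult:
  assumes "invertible A" "invertible B" "invertible T"
  shows "\<exists>c. c \<noteq> 0 \<and> transpose A ** psi (A ** P ** T) (B ** Q ** T) ** B = c *\<^sub>R psi P Q"
proof (intro exI conjI)
  show "det (image_block A B) * det (world_block T) \<noteq> 0"
    using assms by (simp add: det_image_block det_world_block)
  show "transpose A ** psi (A ** P ** T) (B ** Q ** T) ** B =
      (det (image_block A B) * det (world_block T)) *\<^sub>R psi P Q"
    unfolding matrix_eq_inner
  proof (intro allI)
    fix x y
    have "x \<bullet> ((transpose A ** psi (A ** P ** T) (B ** Q ** T) ** B) *v y) =
        (A *v x) \<bullet> (psi (A ** P ** T) (B ** Q ** T) *v (B *v y))"
      by (simp only: inner_transpose_mult flip: matrix_vector_mul_assoc)
    also have "\<dots> = det (image_block A B) * det (world_block T) * (x \<bullet> (psi P Q *v y))"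
      by (simp add: two_view_matrix_mult det_mul flip: det_two_view_matrix)
    finally show "x \<bullet> ((transpose A ** psi (A ** P ** T) (B ** Q ** T) ** B) *v y) =
        x \<bullet> (((det (image_block A B) * det (world_block T)) *\<^sub>R psi P Q) *v y)"
      by (simp flip: scaleR_matrix_vector_assoc)
  qed
qed

section \<open>Normalised cameras and skew-symmetric forms\<close>

text \<open>The normal form \<open>[I | t]\<close>, whose centre \<open>(-t, 1)\<close> lies off the
  plane at infinity.\<close>

definition affine_camera :: "real^3 \<Rightarrow> real^4^3" where
  "affine_camera t = vector [
     vector [1, 0, 0, t$1],
     vector [0, 1, 0, t$2],
     vector [0, 0, 1, t$3]]"

definition skew :: "real^3 \<Rightarrow> real^3^3" where
  "skew t = matrix (cross3 t)"

lemma skew_mult: "skew t *v y = cross3 t y"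
  unfolding skew_def by (simp add: matrix_works cross_add_right cross_mult_right linearI)

lemma skew_diff: "skew (s - t) = skew s - skew t"
  by (simp add: matrix_eq matrix_vector_mult_diff_rdistrib skew_mult Cross3.left_diff_distrib)

lemma transpose_skew: "transpose (skew t) = skew (- t)"
  unfolding matrix_eq_inner
  by (simp add: inner_transpose_mult skew_mult del: transpose_matrix_vector)
    (metis cross_skew cross_triple inner_commute inner_minus_right)

lemma det_eq_0_iff_kernel:
  fixes A :: "real^'n^'n"
  shows "det A = 0 \<longleftrightarrow> (\<exists>w. w \<noteq> 0 \<and> A *v w = 0)"
  by (metis invertible_det_nz invertible_left_inverse matrix_left_invertible_ker
      matrix_vector_mult_0_right)

text \<open>A kernel vector consists of \<open>(a, b, c, d)\<close> in world coordinates and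
  coefficients \<open>e\<close>, \<open>f\<close> of the image points. Eliminating
  \<open>(a, b, c)\<close> from the two block rows leaves a linear relation between
  \<open>x\<close>, \<open>s - t\<close> and \<open>y\<close>, that is, a vanishing triple
  product.\<close>

lemma det_two_view_affine_eq_0_iff:
  "det (two_view_matrix (affine_camera s) (affine_camera t) x y) = 0 \<longleftrightarrow>
     x \<bullet> cross3 (s - t) y = 0"
proof -
  have ex6: "(\<exists>w::real^6. R w) \<longleftrightarrow> (\<exists>a b c d e f. R (vector [a, b, c, d, e, f]))" for R
  proof -
    have "\<exists>a b c d e f. w = vector [a, b, c, d, e, f]" for w :: "real^6"
      by (simp add: entrywise)
    then show ?thesis by metis
  qed
  have ex3: "(\<exists>w::real^3. R w) \<longleftrightarrow> (\<exists>a b c. R (vector [a, b, c]))" for R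
  proof -
    have "\<exists>a b c. w = vector [a, b, c]" for w :: "real^3"
      by (simp add: entrywise)
    then show ?thesis by metis
  qed
  have "det (two_view_matrix (affine_camera s) (affine_camera t) x y) = 0 \<longleftrightarrow>
      (\<exists>a b c d e f. (a, b, c, d, e, f) \<noteq> (0, 0, 0, 0, 0, 0) \<and>
         vector [a, b, c] + d *\<^sub>R s + e *\<^sub>R x = 0 \<and> vector [a, b, c] + d *\<^sub>R t + f *\<^sub>R y = 0)"
    unfolding det_eq_0_iff_kernel ex6
    by (simp add: two_view_matrix_def affine_camera_def entrywise mult.commute)
  also have "\<dots> \<longleftrightarrow> (\<exists>e d f. (e, d, f) \<noteq> (0, 0, 0) \<and> e *\<^sub>R x + d *\<^sub>R (s - t) + f *\<^sub>R y = 0)"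
    (is "?L = ?R")
  proof
    assume ?L
    then obtain a b c d e f where nz: "(a, b, c, d, e, f) \<noteq> (0, 0, 0, 0, 0, 0)"
      and *: "vector [a, b, c] + d *\<^sub>R s + e *\<^sub>R x = 0" "vector [a, b, c] + d *\<^sub>R t + f *\<^sub>R y = 0"
      by blast
    have "(e, d, - f) \<noteq> (0, 0, 0)"
    proof
      assume "(e, d, - f) = (0, 0, 0)"
      with * have "(vector [a, b, c] :: real^3) = 0" "e = 0" "d = 0" "f = 0" by auto
      with nz show False by (simp add: entrywise)
    qed
    moreover have "e *\<^sub>R x + d *\<^sub>R (s - t) + (- f) *\<^sub>R y =
       (vector [a, b, c] + d *\<^sub>R s + e *\<^sub>R x) - (vector [a, b, c] + d *\<^sub>R t + f *\<^sub>R y)"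
      by (simp add: algebra_simps)
    ultimately show ?R unfolding * by (metis diff_zero)
  next
    assume ?R
    then obtain e d f where nz: "(e, d, f) \<noteq> (0, 0, 0)"
      and *: "e *\<^sub>R x + d *\<^sub>R (s - t) + f *\<^sub>R y = 0" by blast
    \<comment> \<open>The first block row determines \<open>(a, b, c)\<close>; the second then
      follows from the given relation, with the sign of \<open>f\<close> reversed.\<close>
    define w where "w = - (d *\<^sub>R s + e *\<^sub>R x)"
    have w: "vector [w$1, w$2, w$3] = w" by (simp add: entrywise)
    have "vector [w$1, w$2, w$3] + d *\<^sub>R s + e *\<^sub>R x = 0" "vector [w$1, w$2, w$3] + d *\<^sub>R t + (- f) *\<^sub>R y = 0"
      unfolding w using * by (simp_all add: w_def algebra_simps)
    moreover have "(w$1, w$2, w$3, d, e, - f) \<noteq> (0, 0, 0, 0, 0, 0)" using nz by auto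
    ultimately show ?L by blast
  qed
  also have "\<dots> \<longleftrightarrow> det (transpose (vector [x, s - t, y]) :: real^3^3) = 0"
    unfolding det_eq_0_iff_kernel ex3
    by (simp add: entrywise transpose_def mult.commute)
  finally show ?thesis
    by (simp add: dot_cross_det)
qed

text \<open>Inverse of \<open>skew\<close> on skew-symmetric matrices. Being defined and linear on
  all matrices, it also applies to a potential whose values need not be skew-symmetric.\<close>

definition axial :: "real^3^3 \<Rightarrow> real^3" where
  "axial K = vector [K$3$2, K$1$3, K$2$1]"

lemma axial_diff: "axial (K - L) = axial K - axial L"
  by (simp add: axial_def entrywise)

lemma skew_axial:
  assumes "transpose K = - K"
  shows "skew (axial K) = K"
proof -
  have K: "K $ i $ j = - K $ j $ i" for i j
    using arg_cong [OF assms, of "\<lambda>K. K $ j $ i"] by (simp add: transpose_def)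
  have "K $ i $ i = 0" for i
    using K [of i i] by linarith
  then show ?thesis
    using K [of 1 2] K [of 2 3] K [of 3 1]
    unfolding matrix_eq skew_mult
    by (simp add: axial_def cross3_def entrywise)
qed

text \<open>Knowing where the form \<open>(x, y) \<mapsto> x \<bullet> (K *v y)\<close> vanishes determines \<open>K\<close> up to scale;
  this avoids evaluating any 6 by 6 determinant.\<close>

lemma skew_unique:
  assumes eq: "\<And>x y. x \<bullet> (K *v y) = 0 \<longleftrightarrow> x \<bullet> cross3 d y = 0"
  shows "\<exists>c. c \<noteq> 0 \<and> K = c *\<^sub>R skew d"
proof -
  \<comment> \<open>For \<open>y = x\<close> the triple product has a repeated vector, so the form
    of \<open>K\<close> is alternating; polarization makes it skew-symmetric.\<close>
  have alt: "x \<bullet> (K *v x) = 0" for x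
    unfolding eq by (simp add: dot_cross_self)
  have skew: "x \<bullet> (K *v y) = - (y \<bullet> (K *v x))" for x y
    using alt [of "x + y"] alt [of x] alt [of y]
    by (simp add: matrix_vector_right_distrib inner_add_left inner_add_right)
  have comp: "axis i 1 \<bullet> (K *v axis j 1) = K $ i $ j" for i j
    by (simp add: matrix_vector_mult_basis column_def inner_axis')
  have "transpose K = - K"
    unfolding vec_eq_iff
  proof (intro allI)
    show "transpose K $ i $ j = (- K) $ i $ j" for i j
      using skew [of "axis j 1" "axis i 1"] by (simp add: comp transpose_def)
  qed
  then have K: "K *v y = cross3 (axial K) y" for y
    by (simp add: skew_axial flip: skew_mult)
  show ?thesis
  proof (cases "d = 0")
    case True
    then have "K = 1 *\<^sub>R skew d"
      unfolding matrix_eq_inner using eq by (simp add: skew_mult)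
    then show ?thesis by (metis zero_neq_one)
  next
    case False
    \<comment> \<open>Testing with \<open>x = K *v d\<close> shows that this vector is orthogonal to
      itself. Hence \<open>axial K\<close> is parallel to \<open>d\<close>.\<close>
    have "K *v d = 0"
      using eq [of "K *v d" d] by simp
    then have "collinear {0, d, axial K}"
      by (simp add: K cross_eq_0 insert_commute)
    then obtain c where c: "axial K = c *\<^sub>R d"
      using False by (auto simp: collinear_lemma)
    have "c \<noteq> 0"
    proof
      assume "c = 0"
      then have "cross3 d y = 0" for y
        using eq [of "cross3 d y" y] by (simp add: K c)
      then show False
        using cross_basis_nonzero False by blast
    qed
    moreover have "K = c *\<^sub>R skew d"
      by (simp add: matrix_eq K c skew_mult cross_mult_left flip: scaleR_matrix_vector_assoc)
    ultimately show ?thesis by blast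
  qed
qed

lemma psi_affine_camera:
  "\<exists>c. c \<noteq> 0 \<and> psi (affine_camera s) (affine_camera t) = c *\<^sub>R skew (s - t)"
  by (rule skew_unique) (simp add: det_two_view_affine_eq_0_iff flip: det_two_view_matrix)

lemma psi_affine_camera_mult:
  assumes "invertible A" "invertible B" "invertible T"
  shows "\<exists>c. c \<noteq> 0 \<and>
    transpose A ** psi (A ** affine_camera s ** T) (B ** affine_camera t ** T) ** B =
      c *\<^sub>R skew (s - t)"
proof -
  obtain c where "c \<noteq> 0"
    "transpose A ** psi (A ** affine_camera s ** T) (B ** affine_camera t ** T) ** B =
      c *\<^sub>R psi (affine_camera s) (affine_camera t)"
    using psi_mult [OF assms] by blast
  moreover obtain d where "d \<noteq> 0" "psi (affine_camera s) (affine_camera t) = d *\<^sub>R skew (s - t)"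
    using psi_affine_camera by blast
  ultimately show ?thesis
    by (intro exI [of _ "c * d"]) simp
qed

section \<open>Moving the camera centres off the plane at infinity\<close>

text \<open>\<open>c\<close> represents the camera centre: the kernel is orthogonal to the row
  space, whose complement has dimension 4 - 3 = 1.\<close>

lemma camera_kernel:
  assumes "is_camera P"
  shows "\<exists>c. c \<noteq> 0 \<and> {v. P *v v = 0} \<subseteq> span {c}"
proof -
  let ?K = "{v. \<forall>x\<in>span (rows P). orthogonal x v}"
  have "dim ?K + dim (rows P) = DIM(real^4)"
    using dim_subspace_orthogonal_to_vectors [OF subspace_span subspace_UNIV subset_UNIV, of "rows P"]
    by simp
  moreover have "dim (rows P) = 3"
    using assms by (simp add: is_camera_def row_rank_def)
  ultimately have 1: "dim ?K = 1" by simp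
  obtain B where "B \<subseteq> ?K" and B: "independent B" "?K \<subseteq> span B" "card B = dim ?K"
    by (rule basis_exists)
  with 1 have "card B = 1" by simp
  then obtain c where c: "B = {c}"
    by (auto simp: card_1_singleton_iff)
  have "{v. P *v v = 0} \<subseteq> ?K"
    using orthogonal_nullspace_rowspace [of P]
    by (simp add: subset_iff orthogonal_def inner_commute)
  then have "{v. P *v v = 0} \<subseteq> span {c}"
    using B(2) c by blast
  moreover have "c \<noteq> 0"
    using B(1) c dependent_single by blast
  ultimately show ?thesis by blast
qed

text \<open>The projective change of coordinates that sends the plane with coordinates
  \<open>(h, 1)\<close> to infinity.\<close>

definition world_shear :: "real^3 \<Rightarrow> real^4^4" where
  "world_shear h = vector [
     vector [1, 0, 0, 0],
     vector [0, 1, 0, 0],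
     vector [0, 0, 1, 0],
     vector [h$1, h$2, h$3, 1]]"

lemma invertible_world_shear: "invertible (world_shear h)"
proof -
  have "world_shear h ** world_shear (- h) = mat 1"
    by (simp add: world_shear_def entrywise)
  then show ?thesis
    by (auto simp: invertible_right_inverse)
qed

lemma affine_camera_world_shear:
  "A ** affine_camera t ** world_shear h =
     (\<chi> i. vector [A$i$1 + (A *v t)$i * h$1, A$i$2 + (A *v t)$i * h$2,
       A$i$3 + (A *v t)$i * h$3, (A *v t)$i])"
  by (simp add: affine_camera_def world_shear_def entrywise algebra_simps)

text \<open>The plane with coordinates \<open>(x, x\<^sup>2, x\<^sup>3, 1)\<close> is moved to infinity. It contains the
  centre \<open>c\<close> of \<open>P\<close> only if \<open>x\<close> is a root of a nonzero cubic.\<close>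

lemma finite_bad_shears:
  assumes "is_camera P"
  shows "finite {x. \<nexists>A t. invertible A \<and>
    P = A ** affine_camera t ** world_shear (vector [x, x^2, x^3])}"
proof -
  obtain c where c: "c \<noteq> 0" "{v. P *v v = 0} \<subseteq> span {c}"
    using camera_kernel [OF assms] by blast
  \<comment> \<open>The plane's coordinates evaluated at the centre \<open>c\<close>.\<close>
  define p where "p x = c$4 + c$1 * x + c$2 * x^2 + c$3 * x^3" for x
  have "\<exists>A t. invertible A \<and> P = A ** affine_camera t ** world_shear (vector [x, x^2, x^3])"
    if "p x \<noteq> 0" for x
  proof -
    let ?h = "vector [x, x^2, x^3] :: real^3"
    \<comment> \<open>Forced by \<open>affine_camera_world_shear\<close>: the last column of
      \<open>P\<close> must be \<open>A *v t\<close>, so \<open>A\<close> is the left block of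
      \<open>P\<close> minus that column times the row \<open>?h\<close>.\<close>
    define A :: "real^3^3" where "A = vector [
      vector [P$1$1 - P$1$4 * x, P$1$2 - P$1$4 * x^2, P$1$3 - P$1$4 * x^3],
      vector [P$2$1 - P$2$4 * x, P$2$2 - P$2$4 * x^2, P$2$3 - P$2$4 * x^3],
      vector [P$3$1 - P$3$4 * x, P$3$2 - P$3$4 * x^2, P$3$3 - P$3$4 * x^3]]"
    have "v = 0" if "A *v v = 0" for v
    proof -
      \<comment> \<open>A kernel vector of \<open>A\<close> extends to a kernel vector of
        \<open>P\<close> lying in the plane. It is a multiple of the centre, which is not in the
        plane, so the multiple is zero.\<close>
      have "P *v vector [v$1, v$2, v$3, - (?h \<bullet> v)] = A *v v"
        by (simp add: A_def entrywise inner_vec_def algebra_simps)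
      then have "vector [v$1, v$2, v$3, - (?h \<bullet> v)] \<in> span {c}"
        using c that by auto
      then obtain s where "vector [v$1, v$2, v$3, - (?h \<bullet> v)] = s *\<^sub>R c"
        by (auto simp: span_singleton)
      then have s: "v$1 = s * c$1" "v$2 = s * c$2" "v$3 = s * c$3" "- (?h \<bullet> v) = s * c$4"
        by (simp_all add: entrywise)
      have "s * p x = 0"
        using s(4) by (simp add: p_def inner_vec_def sum_3 s algebra_simps)
      then show "v = 0"
        using s \<open>p x \<noteq> 0\<close> by (simp add: entrywise)
    qed
    then have inv: "invertible A"
      by (auto simp: invertible_left_inverse matrix_left_invertible_ker)
    then obtain B where "A ** B = mat 1"
      by (auto simp: invertible_def)
    then have "A *v (B *v column 4 P) = column 4 P"
      by (simp add: matrix_vector_mul_assoc)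
    then obtain t where t: "A *v t = column 4 P"
      by blast
    have "P = A ** affine_camera t ** world_shear ?h"
      by (simp add: affine_camera_world_shear t, simp add: A_def entrywise column_def)
    with inv show ?thesis by blast
  qed
  then have "{x. \<nexists>A t. invertible A \<and>
      P = A ** affine_camera t ** world_shear (vector [x, x^2, x^3])} \<subseteq> {x. p x = 0}"
    by blast
  moreover have "finite {x. p x = 0}"
  proof -
    define a where "a i = (if i = 0 then c$4 else c $ of_nat i)" for i :: nat
    have "p x = (\<Sum>i\<le>3. a i * x^i)" for x
      by (simp add: p_def a_def numeral_eq_Suc)
    moreover have "\<exists>i\<le>3. a i \<noteq> 0"
    proof (rule ccontr)
      assume "\<not> ?thesis"
      then have "a 0 = 0" "a 1 = 0" "a 2 = 0" "a 3 = 0" by auto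
      with \<open>c \<noteq> 0\<close> show False by (simp add: a_def vec_eq_iff forall_4)
    qed
    ultimately show ?thesis
      using polyfun_finite_roots [of a 3] by simp
  qed
  ultimately show ?thesis
    by (rule finite_subset)
qed

text \<open>Each camera excludes finitely many parameters \<open>x\<close>, so one parameter suits
  all of them. This provides a common \<open>T\<close>, as \<open>psi_mult\<close> applies the same
  change of world coordinates to both cameras.\<close>

lemma cameras_in_affine_position:
  assumes "finite V" and "\<And>i. i \<in> V \<Longrightarrow> is_camera (P i)"
  obtains A t T where "invertible T"
    and "\<And>i. i \<in> V \<Longrightarrow> invertible (A i)"
    and "\<And>i. i \<in> V \<Longrightarrow> P i = A i ** affine_camera (t i) ** T"
proof -
  define R where "R i x A t \<longleftrightarrow>
    invertible A \<and> P i = A ** affine_camera t ** world_shear (vector [x, x^2, x^3])" for i x A t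
  have "finite {x. \<nexists>A t. R i x A t}" if "i \<in> V" for i
    unfolding R_def by (rule finite_bad_shears) (rule assms(2) [OF that])
  then have "finite (\<Union>i\<in>V. {x. \<nexists>A t. R i x A t})"
    using assms(1) by simp
  from ex_new_if_finite [OF infinite_UNIV_char_0 this]
  obtain x where "\<forall>i\<in>V. \<exists>A t. R i x A t"
    by blast
  then obtain A t where "\<forall>i\<in>V. R i x (A i) (t i)"
    by metis
  then show ?thesis
    by (intro that [of "world_shear (vector [x, x^2, x^3])" A t])
      (auto simp: R_def invertible_world_shear)
qed

section \<open>Compatible cameras and vanishing cycle sums\<close>

text \<open>Points at infinity \<open>(v, 0)\<close> are mapped to \<open>A *v v\<close>, so they
  already cover the image space.\<close>

lemma is_camera_affine:
  assumes "invertible A"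
  shows "is_camera (A ** affine_camera t)"
proof -
  obtain B where B: "A ** B = mat 1"
    using assms by (auto simp: invertible_def)
  have "(A ** affine_camera t) *v (vector [(B *v z)$1, (B *v z)$2, (B *v z)$3, 0]) = z" for z
  proof -
    have "affine_camera t *v (vector [(B *v z)$1, (B *v z)$2, (B *v z)$3, 0]) = B *v z"
      by (simp add: affine_camera_def entrywise)
    then show ?thesis
      by (metis B matrix_vector_mul_assoc matrix_vector_mul_lid)
  qed
  then have "surj ((*v) (A ** affine_camera t))"
    by (rule surjI)
  then show ?thesis
    by (simp add: is_camera_def flip: full_rank_surjective)
qed

text \<open>With \<open>H i\<close> the left factor of the normalised camera and suitable scalars,
  the matrices become \<open>skew (t i) - skew (t j)\<close>, which telescope along cycles.\<close>

lemma compatible_imp_cycle_condition: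
  fixes F :: "'v::linorder \<Rightarrow> 'v \<Rightarrow> real^3^3"
  assumes "pair_graph \<G>" and F: "fundamental_matrices_on \<G> F"
    and "compatible_fundamental \<G> F"
  shows "\<exists>H l. (\<forall>i \<in> pverts \<G>. invertible (H i)) \<and>
    (\<forall>(i, j) \<in> parcs \<G>. l i j = l j i \<and> l i j \<noteq> 0) \<and>
    cycle_condition \<G> (\<lambda>i j. l i j *\<^sub>R (transpose (H i) ** F i j ** H j))"
proof -
  interpret pair_graph \<G> by fact
  obtain P where P: "\<And>i. i \<in> pverts \<G> \<Longrightarrow> is_camera (P i)"
    and FP: "fundamental_matrices_of_cameras \<G> F P"
    using assms(3) by (auto simp: compatible_fundamental_def)
  obtain A t T where T: "invertible T"
    and A: "\<And>i. i \<in> pverts \<G> \<Longrightarrow> invertible (A i)"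
    and PA: "\<And>i. i \<in> pverts \<G> \<Longrightarrow> P i = A i ** affine_camera (t i) ** T"
    using cameras_in_affine_position [OF pair_finite_verts, of P] P by metis
  have "\<exists>c. c \<noteq> 0 \<and> c *\<^sub>R (transpose (A i) ** F i j ** A j) = skew (t i - t j)"
    if ij: "(i, j) \<in> parcs \<G>" for i j
  proof -
    have V: "i \<in> pverts \<G>" "j \<in> pverts \<G>"
      using ij by (auto dest: wellformed')
    obtain c where c: "c \<noteq> 0" "F i j = c *\<^sub>R psi (P i) (P j)"
      using FP ij unfolding fundamental_matrices_of_cameras_def by blast
    obtain d where "d \<noteq> 0" "transpose (A i) ** psi (P i) (P j) ** A j = d *\<^sub>R skew (t i - t j)"
      using psi_affine_camera_mult [OF A [OF V(1)] A [OF V(2)] T] by (metis PA V)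
    then show ?thesis
      using c by (intro exI [of _ "1 / (c * d)"])
        (simp add: matrix_scalar_ac flip: scalar_matrix_assoc)
  qed
  then obtain c where c: "\<And>i j. (i, j) \<in> parcs \<G> \<Longrightarrow> c i j \<noteq> 0"
    "\<And>i j. (i, j) \<in> parcs \<G> \<Longrightarrow> c i j *\<^sub>R (transpose (A i) ** F i j ** A j) = skew (t i - t j)"
    by metis
  \<comment> \<open>The scalars \<open>c i j\<close> were chosen separately for the two arcs of an
    edge. The order on vertices selects one of them for both; the reversed arc is then handled by
    transposition.\<close>
  define l where "l i j = c (min i j) (max i j)" for i j
  have l: "l i j = l j i" "(i, j) \<in> parcs \<G> \<Longrightarrow> l i j \<noteq> 0" for i j
    using c(1) arcs_symmetric by (auto simp: l_def min_def max_def)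
  have skew: "l i j *\<^sub>R (transpose (A i) ** F i j ** A j) = skew (t i - t j)"
    if ij: "(i, j) \<in> parcs \<G>" for i j
  proof (cases "i \<le> j")
    case True
    then show ?thesis using c(2) [OF ij] by (simp add: l_def min_def max_def)
  next
    case False
    have "F i j = transpose (F j i)"
      using F arcs_symmetric [OF ij] by (auto simp: fundamental_matrices_on_def)
    then have "l i j *\<^sub>R (transpose (A i) ** F i j ** A j) =
        transpose (c j i *\<^sub>R (transpose (A j) ** F j i ** A i))"
      using False by (simp add: l_def min_def max_def matrix_transpose_mul matrix_mul_assoc
        transpose_scalar)
    then show ?thesis
      using c(2) [OF arcs_symmetric [OF ij]] by (simp add: transpose_skew)
  qed
  have "cycle_condition \<G> (\<lambda>i j. l i j *\<^sub>R (transpose (A i) ** F i j ** A j))"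
    unfolding cycle_condition_def
  proof (intro allI impI)
    fix C assume C: "cycle C"
    then have "set C \<subseteq> parcs \<G>"
      by (auto simp: cycle_def awalk_def)
    then have "(\<Sum>(i, j)\<in>set C. l i j *\<^sub>R (transpose (A i) ** F i j ** A j)) =
        (\<Sum>e\<in>set C. skew (t (fst e)) - skew (t (snd e)))"
      by (intro sum.cong refl) (auto simp: skew skew_diff)
    also have "\<dots> = 0"
      using sum_cycle_telescope [OF C, of "\<lambda>i. skew (t i)"] .
    finally show "(\<Sum>(i, j)\<in>set C. l i j *\<^sub>R (transpose (A i) ** F i j ** A j)) = 0" .
  qed
  with A l show ?thesis
    by (intro exI [of _ A] exI [of _ l]) auto
qed

lemma invertible_mat_1: "invertible (mat 1 :: real^'n^'n)"
  by (auto simp: invertible_def)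

lemma matrix_mult_cancel:
  assumes "invertible A" "invertible B" and eq: "A ** X ** B = A ** Y ** B"
  shows "X = Y"
proof -
  obtain C D where CD: "C ** A = mat 1" "B ** D = mat 1"
    using assms(1,2) by (auto simp: invertible_def)
  have "C ** (A ** Z ** B) ** D = Z" for Z
  proof -
    have "C ** (A ** Z ** B) ** D = (C ** A) ** Z ** (B ** D)"
      by (simp only: matrix_mul_assoc)
    then show ?thesis by (simp add: CD)
  qed
  then show ?thesis
    using eq by metis
qed

text \<open>A potential of the rescaled matrices supplies vectors \<open>t i\<close>; the cameras
  \<open>H i ** affine_camera (t i)\<close> then realise \<open>F\<close> after cancelling the
  invertible factors.\<close>

lemma cycle_condition_imp_compatible:
  assumes "pair_graph \<G>" and F: "fundamental_matrices_on \<G> F"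
    and H: "\<And>i. i \<in> pverts \<G> \<Longrightarrow> invertible (H i)"
    and l: "\<And>i j. (i, j) \<in> parcs \<G> \<Longrightarrow> l i j = l j i \<and> l i j \<noteq> 0"
    and cyc: "cycle_condition \<G> (\<lambda>i j. l i j *\<^sub>R (transpose (H i) ** F i j ** H j))"
  shows "compatible_fundamental \<G> F"
proof -
  interpret pair_graph \<G> by fact
  define G where "G i j = l i j *\<^sub>R (transpose (H i) ** F i j ** H j)" for i j
  have G0: "(\<Sum>(i, j)\<in>set C. G i j) = 0" if "cycle C" for C
    using cyc that by (simp add: cycle_condition_def G_def)
  have skew: "transpose (G i j) = - G i j" if ij: "(i, j) \<in> parcs \<G>" for i j
  proof -
    have "i \<noteq> j" using ij by (rule no_loops')
    \<comment> \<open>The 2-cycle gives \<open>G j i = - G i j\<close>, whereas symmetry of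
      \<open>l\<close> and transposition of \<open>F\<close> give
      \<open>G j i = transpose (G i j)\<close>.\<close>
    have "cycle [(i, j), (j, i)]"
      using ij arcs_symmetric [OF ij] \<open>i \<noteq> j\<close>
      by (auto simp: cycle_def awalk_simps dest: wellformed')
    from G0 [OF this] have "G i j + G j i = 0"
      using \<open>i \<noteq> j\<close> by simp
    moreover have "F j i = transpose (F i j)"
      using F ij by (auto simp: fundamental_matrices_on_def)
    then have "transpose (G i j) = G j i"
      using l [OF ij] by (simp add: G_def matrix_transpose_mul matrix_mul_assoc transpose_scalar)
    ultimately show ?thesis
      by (simp add: eq_neg_iff_add_eq_0 add.commute)
  qed
  obtain f where f: "\<forall>e\<in>parcs \<G>. (case e of (i, j) \<Rightarrow> G i j) = f (fst e) - f (snd e)"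
    using potential_exists [of "\<lambda>(i, j). G i j"] G0 by auto
  \<comment> \<open>Only the differences of \<open>f\<close> along arcs are known to be
    skew-symmetric; linearity of \<open>axial\<close> suffices to recover \<open>G\<close>.\<close>
  define t where "t i = axial (f i)" for i
  have G: "G i j = skew (t i - t j)" if "(i, j) \<in> parcs \<G>" for i j
    using bspec [OF f that] skew_axial [OF skew [OF that]] by (simp add: t_def axial_diff)
  \<comment> \<open>The factor \<open>mat 1\<close> puts \<open>P i\<close> in the form of
    \<open>psi_affine_camera_mult\<close> with \<open>T\<close> the identity.\<close>
  define P where "P i = H i ** affine_camera (t i) ** mat 1" for i
  have "is_camera (P i)" if "i \<in> pverts \<G>" for i
    using is_camera_affine [OF H [OF that]] by (simp add: P_def)
  moreover have "\<exists>c. c \<noteq> 0 \<and> F i j = c *\<^sub>R psi (P i) (P j)" if ij: "(i, j) \<in> parcs \<G>" for i j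
  proof -
    have V: "i \<in> pverts \<G>" "j \<in> pverts \<G>"
      using ij by (auto dest: wellformed')
    obtain c where c: "c \<noteq> 0" "transpose (H i) ** psi (P i) (P j) ** H j = c *\<^sub>R G i j"
      unfolding P_def G [OF ij]
      using psi_affine_camera_mult [OF H [OF V(1)] H [OF V(2)] invertible_mat_1] by blast
    then have "transpose (H i) ** psi (P i) (P j) ** H j =
        transpose (H i) ** ((c * l i j) *\<^sub>R F i j) ** H j"
      by (simp add: G_def matrix_scalar_ac flip: scalar_matrix_assoc)
    then have "psi (P i) (P j) = (c * l i j) *\<^sub>R F i j"
      by (rule matrix_mult_cancel [OF transpose_invertible [OF H [OF V(1)]] H [OF V(2)]])
    then show ?thesis
      using c l [OF ij] by (intro exI [of _ "1 / (c * l i j)"]) simp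
  qed
  ultimately show ?thesis
    unfolding compatible_fundamental_def fundamental_matrices_of_cameras_def
    by (intro exI [of _ P]) auto
qed



theorem theorem4p1:
  fixes n :: nat
    and \<G> :: "nat pair_pre_digraph"
    and F :: "nat \<Rightarrow> nat \<Rightarrow> real^3^3"
  assumes "pair_graph \<G>"
    and "pverts \<G> = {1..n}"
    and "fundamental_matrices_on \<G> F"
  shows "(compatible_fundamental \<G> F \<longleftrightarrow>
           (\<exists>(H :: nat \<Rightarrow> real^3^3) (l :: nat \<Rightarrow> nat \<Rightarrow> real).
              (\<forall>i \<in> pverts \<G>. invertible (H i)) \<and>
              (\<forall>(i, j) \<in> parcs \<G>. l i j = l j i \<and> l i j \<noteq> 0) \<and>
              cycle_condition \<G> (\<lambda>i j. l i j *\<^sub>R (transpose (H i) ** F i j ** H j))))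
       \<and> (\<forall>G. fundamental_matrices_on \<G> G \<and> cycle_condition \<G> G \<longrightarrow>
              compatible_fundamental \<G> G)"
proof (intro conjI iffI allI impI)
  assume "compatible_fundamental \<G> F"
  then show "\<exists>H l. (\<forall>i \<in> pverts \<G>. invertible (H i)) \<and>
      (\<forall>(i, j) \<in> parcs \<G>. l i j = l j i \<and> l i j \<noteq> 0) \<and>
      cycle_condition \<G> (\<lambda>i j. l i j *\<^sub>R (transpose (H i) ** F i j ** H j))"
    using compatible_imp_cycle_condition assms by blast
next
  assume "\<exists>H l. (\<forall>i \<in> pverts \<G>. invertible (H i)) \<and>
      (\<forall>(i, j) \<in> parcs \<G>. l i j = l j i \<and> l i j \<noteq> 0) \<and>
      cycle_condition \<G> (\<lambda>i j. l i j *\<^sub>R (transpose (H i) ** F i j ** H j))"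
  then obtain H l where "\<forall>i \<in> pverts \<G>. invertible (H i)"
    "\<forall>(i, j) \<in> parcs \<G>. l i j = l j i \<and> l i j \<noteq> 0"
    "cycle_condition \<G> (\<lambda>i j. l i j *\<^sub>R (transpose (H i) ** F i j ** H j))"
    by blast
  then show "compatible_fundamental \<G> F"
    by (intro cycle_condition_imp_compatible [OF assms(1,3), of H l]) auto
next
  fix G
  assume "fundamental_matrices_on \<G> G \<and> cycle_condition \<G> G"
  \<comment> \<open>The given matrices already satisfy the condition with identity matrices for
    \<open>H\<close> and all scalars 1.\<close>
  then show "compatible_fundamental \<G> G"
    by (intro cycle_condition_imp_compatible [OF assms(1), of G "\<lambda>_. mat 1" "\<lambda>_ _. 1"])
      (auto simp: invertible_mat_1)
qed

end
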